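(* Let $\{\mathcal{P}_n(x)\}_{n\ge 0}$ be generated by $\mathcal{P}_{-1}(x)=0$, $\mathcal{P}_0(x)=1$, $\mathcal{P}_1(x)=\rho_0(x-c_0)$ and $$\mathcal{P}_{n+1}(x)=\rho_n(x-c_n)\mathcal{P}_n(x)-d_n(x^2+\omega^2)\mathcal{P}_{n-1}(x),\quad n\ge 1,$$ and let $\mathcal{L}_n(x)=\mathcal{P}_n(x)-\alpha_n\mathcal{P}_{n-1}(x)$, $n\ge0$, where the $\alpha_n$ are nonzero real or complex numbers. Suppose that for all $n\ge 1$ $$d_n\alpha_{n-1}\rho_{n-1}=d_{n-1}\alpha_n\rho_n,\qquad \alpha_n=-(\alpha_{n-1}^{-1}d_{n-1}\omega^2+\rho_{n-1}c_{n-1}).$$ Then $\{\mathcal{L}_n\}$ satisfies the special $R_{II}$ type recurrence $$\mathcal{L}_{n+1}(x)=\rho_n\left(x+\frac{f_n^{-1}r_n}{\rho_n}\right)\mathcal{L}_n(x)-d_n(x^2+\omega^2)\mathcal{L}_{n-1}(x),\quad n\ge 1,$$ with $\mathcal{L}_1(x)=\rho_0(x-\alpha_1\rho_0^{-1}-c_0)$ and $\mathcal{L}_0(x)=1$, where $$f_n=-\alpha_{n-1}\rho_{n-1},\qquad r_n=\alpha_{n-1}\rho_{n-1}[\alpha_{n+1}+\rho_n(c_n+c_{n-1})]+\rho_nd_{n-1}\omega^2 .$$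
   Context: Here $\omega\in\mathbb{R}\setminus\{0\}$, $\{\rho_n\}_{n\ge0}$ and $\{c_n\}_{n\ge0}$ are real sequences with $\rho_n\ge 1$, and $\{d_n\}_{n\ge1}$ is a positive chain sequence, i.e. there is a sequence $\{\xi_n\}_{n\ge0}$ with $0\le \xi_0<1$, $0<\xi_n<1$ for $n\ge1$, and $d_n=(1-\xi_{n-1})\xi_n$ for $n\ge 1$. The constants $d_0$ and $\alpha_0\neq0$ appearing in the conditions and formulas for $n=1$ are auxiliary constants; they do not influence the polynomials because $\mathcal{P}_{-1}=0$. *)

theory Defs
  imports Complex_Main "HOL-Computational_Algebra.Polynomial"
begin

(* The chain sequence is d 1, d 2, ...; the value d 0 is unconstrained. *)
definition positive_chain_sequence :: "(nat \<Rightarrow> real) \<Rightarrow> bool" where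
  "positive_chain_sequence d \<longleftrightarrow>
     (\<exists>\<xi> :: nat \<Rightarrow> real. 0 \<le> \<xi> 0 \<and> \<xi> 0 < 1 \<and>
        (\<forall>n\<ge>1. 0 < \<xi> n \<and> \<xi> n < 1) \<and>
        (\<forall>n\<ge>1. d n = (1 - \<xi> (n - 1)) * \<xi> n))"

end

theory Submission imports Defs begin

text \<open>
  Under the two conditions on \<open>\<alpha>\<close>, the coefficient \<open>f\<^sub>n\<^sup>-\<^sup>1 r\<^sub>n / \<rho>\<^sub>n\<close> is just \<open>- c\<^sub>n\<^sub>-\<^sub>1\<close>, so the claim is
  that \<open>L\<close> satisfies the recurrence of \<open>P\<close> with \<open>c\<^sub>n\<close> replaced by \<open>c\<^sub>n\<^sub>-\<^sub>1\<close>. With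
  \<open>\<sigma> = \<rho>\<^sub>n / \<rho>\<^sub>n\<^sub>-\<^sub>1\<close> the conditions give
  \<open>\<alpha>\<^sub>n\<^sub>+\<^sub>1 + \<rho>\<^sub>n c\<^sub>n = \<rho>\<^sub>n c\<^sub>n\<^sub>-\<^sub>1 + \<sigma> \<alpha>\<^sub>n\<close> and \<open>d\<^sub>n \<alpha>\<^sub>n\<^sub>-\<^sub>1 = \<sigma> \<alpha>\<^sub>n d\<^sub>n\<^sub>-\<^sub>1\<close>. They make the difference of
  the two sides of the recurrence for \<open>L\<^sub>n\<^sub>+\<^sub>1\<close> equal to \<open>\<sigma> \<alpha>\<^sub>n\<close> times the defect of the recurrence
  for \<open>P\<^sub>n\<close>, which vanishes. For \<open>n = 1\<close> this uses the recurrence for \<open>P\<^sub>1\<close>, which holds with any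
  value of \<open>d\<^sub>0\<close> because \<open>P\<^sub>-\<^sub>1 = 0\<close>.
\<close>

text \<open>
  In the lemmas below, \<open>a0\<close>, \<open>a1\<close>, \<open>a2\<close> stand for \<open>\<alpha>\<^sub>n\<^sub>-\<^sub>1\<close>, \<open>\<alpha>\<^sub>n\<close>, \<open>\<alpha>\<^sub>n\<^sub>+\<^sub>1\<close>; unprimed coefficients have
  index \<open>n\<close> and primed ones index \<open>n - 1\<close>; \<open>w\<close> stands for \<open>\<omega>\<^sup>2\<close>,
  and \<open>s\<close> for \<open>\<sigma>\<close>.
\<close>

lemma alpha_relation:
  fixes a0 a1 a2 \<rho> \<rho>' c c' d d' w :: "'a::field"
  assumes nz: "a0 \<noteq> 0" "a1 \<noteq> 0" "\<rho>' \<noteq> 0"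
    and cross: "d * a0 * \<rho>' = d' * a1 * \<rho>"
    and a1: "a1 = - (inverse a0 * d' * w + \<rho>' * c')"
    and a2: "a2 = - (inverse a1 * d * w + \<rho> * c)"
  shows "a2 + \<rho> * c = \<rho> * c' + (\<rho> / \<rho>') * a1"
proof -
  have d: "d = d' * a1 * \<rho> / (a0 * \<rho>')"
    using nz cross by (simp add: field_simps)
  have "a2 + \<rho> * c = - (inverse a1 * d * w)"
    by (simp add: a2)
  also have "\<dots> = - (\<rho> / \<rho>') * (inverse a0 * d' * w)"
    unfolding d using nz by (simp add: field_simps)
  also have "inverse a0 * d' * w = - (a1 + \<rho>' * c')"
    by (subst a1) simp
  finally show ?thesis
    using nz by (simp add: field_simps)
qed

lemma coefficient_eq_minus_c:
  fixes a0 a1 a2 \<rho> \<rho>' c c' d' w :: "'a::field"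
  assumes nz: "a0 \<noteq> 0" "\<rho> \<noteq> 0" "\<rho>' \<noteq> 0"
    and a1: "a1 = - (inverse a0 * d' * w + \<rho>' * c')"
    and rel: "a2 + \<rho> * c = \<rho> * c' + (\<rho> / \<rho>') * a1"
  shows "inverse (- a0 * \<rho>') * (a0 * \<rho>' * (a2 + \<rho> * (c + c')) + \<rho> * d' * w) / \<rho> = - c'"
proof -
  have w: "d' * w = - a0 * (a1 + \<rho>' * c')"
    by (subst a1) (use nz in \<open>simp add: field_simps\<close>)
  have "a0 * \<rho>' * (a2 + \<rho> * (c + c')) = a0 * \<rho>' * (a2 + \<rho> * c) + a0 * \<rho>' * \<rho> * c'"
    by (simp add: algebra_simps)
  also have "\<dots> = a0 * \<rho>' * \<rho> * c' + a0 * \<rho> * (a1 + \<rho>' * c')"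
    unfolding rel using nz by (simp add: field_simps)
  finally have "a0 * \<rho>' * (a2 + \<rho> * (c + c')) + \<rho> * d' * w = a0 * \<rho>' * \<rho> * c'"
    by (simp add: mult.assoc w)
  then show ?thesis
    using nz by (simp add: field_simps)
qed

text \<open>
  The recurrence step: \<open>Z\<close>, \<open>A\<close>, \<open>B\<close> are \<open>P\<^sub>n\<^sub>-\<^sub>2\<close>, \<open>P\<^sub>n\<^sub>-\<^sub>1\<close>, \<open>P\<^sub>n\<close>, and \<open>q\<close>, which may be any polynomial,
  plays the part of \<open>x\<^sup>2 + \<omega>\<^sup>2\<close>.
\<close>

lemma shifted_recurrence:
  fixes A B Z q :: "'a::comm_ring_1 poly" and s :: 'a
  assumes B: "B = smult \<rho>' ([:- c', 1:] * A) - smult d' (q * Z)"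
    and ratio: "\<rho> = s * \<rho>'"
    and rel: "a2 + \<rho> * c = \<rho> * c' + s * a1"
    and cross: "d * a0 = s * a1 * d'"
  shows "smult \<rho> ([:- c, 1:] * B) - smult d (q * A) - smult a2 B
       = smult \<rho> ([:- c', 1:] * (B - smult a1 A)) - smult d (q * (A - smult a0 Z))"
proof -
  have lin: "[:- e, 1:] = [:0, 1:] - [:e:]" for e :: 'a
    by simp
  have a2: "a2 = \<rho> * c' + s * a1 - \<rho> * c"
    using rel by (simp add: algebra_simps)
  have "smult d (q * (A - smult a0 Z)) = smult d (q * A) - smult (d * a0) (q * Z)"
    by (simp add: algebra_simps smult_diff_right)
  then show ?thesis
    unfolding B cross a2 ratio lin
    by (simp add: algebra_simps smult_diff_right smult_diff_left smult_add_left smult_add_right)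
qed

theorem theorem2p3:
  fixes \<omega> :: real
    and \<rho> c :: "nat \<Rightarrow> real"
    and d \<alpha> f r :: "nat \<Rightarrow> complex"
    and P :: "int \<Rightarrow> complex poly"
    and L :: "nat \<Rightarrow> complex poly"
  assumes omega: "\<omega> \<noteq> 0"
    and rho: "\<And>n. \<rho> n \<ge> 1"
    and d_real: "\<And>n. n \<ge> 1 \<Longrightarrow> d n \<in> \<real>"
    and d_chain: "positive_chain_sequence (\<lambda>n. Re (d n))"
    and alpha_nonzero: "\<And>n. \<alpha> n \<noteq> 0"
    and P_minus1: "P (-1) = 0"
    and P_0: "P 0 = 1"
    and P_1: "P 1 = smult (of_real (\<rho> 0)) [:- of_real (c 0), 1:]"
    and P_rec: "\<And>n. n \<ge> 1 \<Longrightarrow>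
          P (int n + 1) =
            smult (of_real (\<rho> n)) ([:- of_real (c n), 1:] * P (int n))
            - smult (d n) ([:of_real (\<omega>\<^sup>2), 0, 1:] * P (int n - 1))"
    and L_def: "\<And>n. L n = P (int n) - smult (\<alpha> n) (P (int n - 1))"
    and cond1: "\<And>n. n \<ge> 1 \<Longrightarrow>
          d n * \<alpha> (n - 1) * of_real (\<rho> (n - 1)) = d (n - 1) * \<alpha> n * of_real (\<rho> n)"
    and cond2: "\<And>n. n \<ge> 1 \<Longrightarrow>
          \<alpha> n = - (inverse (\<alpha> (n - 1)) * d (n - 1) * of_real (\<omega>\<^sup>2)
                  + of_real (\<rho> (n - 1) * c (n - 1)))"
    and f_def: "\<And>n. n \<ge> 1 \<Longrightarrow> f n = - \<alpha> (n - 1) * of_real (\<rho> (n - 1))"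
    and r_def: "\<And>n. n \<ge> 1 \<Longrightarrow>
          r n = \<alpha> (n - 1) * of_real (\<rho> (n - 1))
                  * (\<alpha> (n + 1) + of_real (\<rho> n * (c n + c (n - 1))))
                + of_real (\<rho> n) * d (n - 1) * of_real (\<omega>\<^sup>2)"
  shows "L 0 = 1
    \<and> L 1 = smult (of_real (\<rho> 0))
              [:- (\<alpha> 1 * inverse (of_real (\<rho> 0))) - of_real (c 0), 1:]
    \<and> (\<forall>n\<ge>1. L (n + 1) =
            smult (of_real (\<rho> n)) ([:inverse (f n) * r n / of_real (\<rho> n), 1:] * L n)
            - smult (d n) ([:of_real (\<omega>\<^sup>2), 0, 1:] * L (n - 1)))"
proof -
  have rho_nz: "complex_of_real (\<rho> n) \<noteq> 0" for n
    using rho[of n] by simp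
  have L_0: "L 0 = 1"
    using L_def[of 0] P_0 P_minus1 by simp
  have L_1: "L 1 = smult (of_real (\<rho> 0))
              [:- (\<alpha> 1 * inverse (of_real (\<rho> 0))) - of_real (c 0), 1:]"
    using L_def[of 1] P_0 P_1 rho_nz[of 0] by (simp add: one_pCons field_simps)
  have P_rec0: "P (int m + 1) = smult (of_real (\<rho> m)) ([:- of_real (c m), 1:] * P (int m))
            - smult (d m) ([:of_real (\<omega>\<^sup>2), 0, 1:] * P (int m - 1))" for m
    using P_rec[of m] P_0 P_1 P_minus1 by (cases "m = 0") simp_all
  have "L (n + 1) =
            smult (of_real (\<rho> n)) ([:inverse (f n) * r n / of_real (\<rho> n), 1:] * L n)
            - smult (d n) ([:of_real (\<omega>\<^sup>2), 0, 1:] * L (n - 1))" if n: "n \<ge> 1" for n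
  proof -
    obtain m where m: "n = Suc m"
      using n by (cases n) simp_all
    define s where "s = complex_of_real (\<rho> n) / of_real (\<rho> m)"
    have a1: "\<alpha> n = - (inverse (\<alpha> m) * d m * of_real (\<omega>\<^sup>2) + of_real (\<rho> m) * of_real (c m))"
      using cond2[of n] m by simp
    have a2: "\<alpha> (n + 1) = - (inverse (\<alpha> n) * d n * of_real (\<omega>\<^sup>2) + of_real (\<rho> n) * of_real (c n))"
      using cond2[of "n + 1"] by simp
    have cross: "d n * \<alpha> m * of_real (\<rho> m) = d m * \<alpha> n * of_real (\<rho> n)"
      using cond1[of n] m by simp
    have rel: "\<alpha> (n + 1) + of_real (\<rho> n) * of_real (c n) = of_real (\<rho> n) * of_real (c m) + s * \<alpha> n"
      unfolding s_def
      by (rule alpha_relation[OF alpha_nonzero alpha_nonzero rho_nz cross a1 a2])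
    have coeff: "inverse (f n) * r n / of_real (\<rho> n) = - of_real (c m)"
      unfolding f_def[OF n] r_def[OF n]
      using coefficient_eq_minus_c[OF alpha_nonzero rho_nz rho_nz a1 rel[unfolded s_def]]
      by (simp add: m)
    have ratio: "of_real (\<rho> n) = s * of_real (\<rho> m)"
      using rho_nz[of m] by (simp add: s_def)
    have cross': "d n * \<alpha> m = s * \<alpha> n * d m"
      using cross rho_nz[of m] by (simp add: s_def field_simps)
    have P_n: "P (int n) = smult (of_real (\<rho> m)) ([:- of_real (c m), 1:] * P (int m))
            - smult (d m) ([:of_real (\<omega>\<^sup>2), 0, 1:] * P (int m - 1))"
      using P_rec0[of m] by (simp add: m add.commute)
    have "L (n + 1) = P (int n + 1) - smult (\<alpha> (n + 1)) (P (int n))"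
      using L_def[of "n + 1"] by (simp add: add.commute)
    also have "\<dots> = smult (of_real (\<rho> n)) ([:- of_real (c n), 1:] * P (int n))
            - smult (d n) ([:of_real (\<omega>\<^sup>2), 0, 1:] * P (int m)) - smult (\<alpha> (n + 1)) (P (int n))"
      using P_rec[OF n] by (simp add: m)
    also have "\<dots> = smult (of_real (\<rho> n)) ([:- of_real (c m), 1:] * (P (int n) - smult (\<alpha> n) (P (int m))))
            - smult (d n) ([:of_real (\<omega>\<^sup>2), 0, 1:] * (P (int m) - smult (\<alpha> m) (P (int m - 1))))"
      by (rule shifted_recurrence[OF P_n ratio rel cross'])
    also have "P (int n) - smult (\<alpha> n) (P (int m)) = L n"
      using L_def[of n] by (simp add: m)
    also have "P (int m) - smult (\<alpha> m) (P (int m - 1)) = L (n - 1)"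
      using L_def[of m] by (simp add: m)
    finally show ?thesis
      by (simp only: coeff)
  qed
  with L_0 L_1 show ?thesis
    by blast
qed

end
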